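(* Let $t_0<t_1$ be real numbers, let $X$ be a Banach space, let $\alpha>0$, and let $f:[t_0,t_1]\to X$. (i) $f\in L^1(t_0,b;X)$ for every $b\in(t_0,t_1)$ if and only if $J^\alpha_{t_0,t}f(t)$ exists for almost every $t\in[t_0,t_1]$. (ii) If $f\in L^1(t_0,t_1;X)$, then the function $t\mapsto J^\alpha_{t_0,t}f(t)$ is Bochner integrable in $[t_0,t_1]$.
   Context: Intervals carry Lebesgue measure. $L^p(a,b;X)$ is the Bochner-Lebesgue space of Bochner (strongly) measurable functions $f:[a,b]\to X$ with $\|f\|_X\in L^p(a,b;\mathbb{R})$. The Riemann-Liouville fractional integral of order $\alpha>0$ at $t_0$ of $f$ is $J^\alpha_{t_0,t}f(t):=\frac{1}{\Gamma(\alpha)}\int_{t_0}^t(t-s)^{\alpha-1}f(s)\,ds$ for every $t$ for which this integral exists, i.e. for which $s\mapsto(t-s)^{\alpha-1}f(s)$ is Bochner integrable on $[t_0,t]$. *)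

theory Defs
  imports "HOL-Analysis.Analysis"
begin

text \<open>
  The library's \<^const>\<open>has_bochner_integral\<close>, \<^const>\<open>integrable\<close> and
  \<^const>\<open>lebesgue_integral\<close> require a second countable (separable) target space. For arbitrary
  Banach spaces, Borel measurability is replaced here by strong (Bochner) measurability.
\<close>

definition bochner_measurable :: "'a measure \<Rightarrow> ('a \<Rightarrow> 'b::real_normed_vector) \<Rightarrow> bool" where
  "bochner_measurable M f \<longleftrightarrow>
     (\<exists>s. (\<forall>i. simple_function M (s i)) \<and> (AE x in M. (\<lambda>i. s i x) \<longlonglongrightarrow> f x))"

definition has_strong_bochner_integral ::
    "'a measure \<Rightarrow> ('a \<Rightarrow> 'b::real_normed_vector) \<Rightarrow> 'b \<Rightarrow> bool" where
  "has_strong_bochner_integral M f y \<longleftrightarrow>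
     bochner_measurable M f \<and>
     (\<exists>s. (\<forall>i. Bochner_Integration.simple_bochner_integrable M (s i)) \<and>
          (\<lambda>i. \<integral>\<^sup>+x. ennreal (norm (f x - s i x)) \<partial>M) \<longlonglongrightarrow> 0 \<and>
          (\<lambda>i. Bochner_Integration.simple_bochner_integral M (s i)) \<longlonglongrightarrow> y)"

definition strong_bochner_integrable ::
    "'a measure \<Rightarrow> ('a \<Rightarrow> 'b::real_normed_vector) \<Rightarrow> bool" where
  "strong_bochner_integrable M f \<longleftrightarrow> (\<exists>y. has_strong_bochner_integral M f y)"

definition strong_bochner_integral ::
    "'a measure \<Rightarrow> ('a \<Rightarrow> 'b::real_normed_vector) \<Rightarrow> 'b" where
  "strong_bochner_integral M f =
     (if strong_bochner_integrable M f then THE y. has_strong_bochner_integral M f y else 0)"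

lemma bochner_measurable_norm_diff:
  assumes "bochner_measurable M f" "simple_function M t"
  obtains h where "h \<in> borel_measurable M" "AE x in M. ennreal (norm (f x - t x)) = h x"
proof -
  obtain s where s: "\<And>i. simple_function M (s i)" "AE x in M. (\<lambda>i. s i x) \<longlonglongrightarrow> f x"
    using assms(1) unfolding bochner_measurable_def by blast
  define h where "h = (\<lambda>x. liminf (\<lambda>i. ennreal (norm (s i x - t x))))"
  have "(\<lambda>x. ennreal (norm (s i x - t x))) \<in> borel_measurable M" for i
    using simple_function_compose2[OF s(1)[of i] assms(2), of "\<lambda>a b. ennreal (norm (a - b))"]
    by (rule borel_measurable_simple_function)
  then have "h \<in> borel_measurable M"
    unfolding h_def by measurable
  moreover have "AE x in M. ennreal (norm (f x - t x)) = h x"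
    using s(2)
  proof eventually_elim
    case (elim x)
    then have "(\<lambda>i. ennreal (norm (s i x - t x))) \<longlonglongrightarrow> ennreal (norm (f x - t x))"
      by (intro tendsto_intros tendsto_ennrealI)
    then show ?case
      unfolding h_def by (intro lim_imp_Liminf[symmetric]) auto
  qed
  ultimately show thesis by (rule that)
qed

lemma simple_bochner_integral_strong_bounded:
  fixes f :: "'a \<Rightarrow> 'b::real_normed_vector"
  assumes f: "bochner_measurable M f"
  assumes s: "Bochner_Integration.simple_bochner_integrable M s" and t: "Bochner_Integration.simple_bochner_integrable M t"
  shows "ennreal (norm (Bochner_Integration.simple_bochner_integral M s - Bochner_Integration.simple_bochner_integral M t)) \<le>
    (\<integral>\<^sup>+ x. norm (f x - s x) \<partial>M) + (\<integral>\<^sup>+ x. norm (f x - t x) \<partial>M)"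
proof -
  have sf: "simple_function M s" "simple_function M t"
    using s t by (auto elim: simple_bochner_integrable.cases)
  obtain g where g: "g \<in> borel_measurable M" "AE x in M. ennreal (norm (f x - s x)) = g x"
    using bochner_measurable_norm_diff[OF f sf(1)] .
  obtain h where h: "h \<in> borel_measurable M" "AE x in M. ennreal (norm (f x - t x)) = h x"
    using bochner_measurable_norm_diff[OF f sf(2)] .
  have "ennreal (norm (Bochner_Integration.simple_bochner_integral M s - Bochner_Integration.simple_bochner_integral M t))
      = norm (Bochner_Integration.simple_bochner_integral M (\<lambda>x. s x - t x))"
    using s t by (subst simple_bochner_integral_diff) auto
  also have "\<dots> \<le> Bochner_Integration.simple_bochner_integral M (\<lambda>x. norm (s x - t x))"
    using simple_bochner_integrable_compose2[of "(-)" M "s" "t"] s t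
    by (auto intro!: simple_bochner_integral_norm_bound)
  also have "\<dots> = (\<integral>\<^sup>+x. norm (s x - t x) \<partial>M)"
    using simple_bochner_integrable_compose2[of "\<lambda>x y. norm (x - y)" M "s" "t"] s t
    by (auto intro!: simple_bochner_integral_eq_nn_integral)
  also have "\<dots> \<le> (\<integral>\<^sup>+x. g x + h x \<partial>M)"
    using g(2) h(2)
  proof (intro nn_integral_mono_AE, eventually_elim)
    case (elim x)
    have "norm (s x - t x) \<le> norm (f x - s x) + norm (f x - t x)"
      using norm_triangle_ineq4[of "f x - t x" "f x - s x"] by simp
    then have "ennreal (norm (s x - t x)) \<le> ennreal (norm (f x - s x) + norm (f x - t x))"
      by (rule ennreal_leI)
    also have "\<dots> = g x + h x"
      unfolding elim(3,4)[symmetric] by (rule ennreal_plus) auto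
    finally show ?case .
  qed
  also have "\<dots> = (\<integral>\<^sup>+x. g x \<partial>M) + (\<integral>\<^sup>+x. h x \<partial>M)"
    by (rule nn_integral_add[OF g(1) h(1)])
  also have "\<dots> = (\<integral>\<^sup>+ x. norm (f x - s x) \<partial>M) + (\<integral>\<^sup>+ x. norm (f x - t x) \<partial>M)"
    using nn_integral_cong_AE[OF g(2)] nn_integral_cong_AE[OF h(2)] by simp
  finally show ?thesis .
qed

lemma has_strong_bochner_integral_unique:
  assumes "has_strong_bochner_integral M f x" "has_strong_bochner_integral M f y"
  shows "x = y"
proof -
  have f: "bochner_measurable M f"
    using assms(1) by (simp add: has_strong_bochner_integral_def)
  obtain s where s: "\<And>i. Bochner_Integration.simple_bochner_integrable M (s i)"
      "(\<lambda>i. \<integral>\<^sup>+x. ennreal (norm (f x - s i x)) \<partial>M) \<longlonglongrightarrow> 0" (is "?S \<longlonglongrightarrow> 0")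
      "(\<lambda>i. Bochner_Integration.simple_bochner_integral M (s i)) \<longlonglongrightarrow> x" (is "?s \<longlonglongrightarrow> x")
    using assms(1) unfolding has_strong_bochner_integral_def by blast
  obtain t where t: "\<And>i. Bochner_Integration.simple_bochner_integrable M (t i)"
      "(\<lambda>i. \<integral>\<^sup>+x. ennreal (norm (f x - t i x)) \<partial>M) \<longlonglongrightarrow> 0" (is "?T \<longlonglongrightarrow> 0")
      "(\<lambda>i. Bochner_Integration.simple_bochner_integral M (t i)) \<longlonglongrightarrow> y" (is "?t \<longlonglongrightarrow> y")
    using assms(2) unfolding has_strong_bochner_integral_def by blast
  have "(\<lambda>i. norm (?s i - ?t i)) \<longlonglongrightarrow> norm (x - y)"
    by (intro tendsto_intros s t)
  moreover
  have "(\<lambda>i. ennreal (norm (?s i - ?t i))) \<longlonglongrightarrow> ennreal 0"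
  proof (rule tendsto_sandwich)
    show "eventually (\<lambda>i. 0 \<le> ennreal (norm (?s i - ?t i))) sequentially" "(\<lambda>_. 0) \<longlonglongrightarrow> ennreal 0"
      by auto
    show "eventually (\<lambda>i. norm (?s i - ?t i) \<le> ?S i + ?T i) sequentially"
      by (intro always_eventually allI simple_bochner_integral_strong_bounded s t f)
    show "(\<lambda>i. ?S i + ?T i) \<longlonglongrightarrow> ennreal 0"
      using tendsto_add[OF s(2) t(2)] by simp
  qed
  then have "(\<lambda>i. norm (?s i - ?t i)) \<longlonglongrightarrow> 0"
    by (simp flip: ennreal_0)
  ultimately have "norm (x - y) = 0"
    by (rule LIMSEQ_unique)
  then show "x = y" by simp
qed

lemma strong_bochner_integral_eq:
  "has_strong_bochner_integral M f y \<Longrightarrow> strong_bochner_integral M f = y"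
  unfolding strong_bochner_integral_def strong_bochner_integrable_def
  by (auto intro: has_strong_bochner_integral_unique)

lemma has_bochner_integral_iff_strong:
  fixes f :: "'a \<Rightarrow> 'b::{real_normed_vector, second_countable_topology}"
  shows "has_bochner_integral M f y \<longleftrightarrow>
    f \<in> borel_measurable M \<and> has_strong_bochner_integral M f y"
proof -
  have "bochner_measurable M f" if f: "f \<in> borel_measurable M"
  proof -
    obtain s where "\<forall>i. simple_function M (s i)"
        "\<forall>x\<in>space M. (\<lambda>i. s i x) \<longlonglongrightarrow> f x"
      using borel_measurable_implies_sequence_metric[OF f, of 0] by blast
    then show ?thesis
      unfolding bochner_measurable_def by (intro exI[of _ s] conjI AE_I2) auto
  qed
  then show ?thesis
    unfolding has_bochner_integral.simps has_strong_bochner_integral_def by auto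
qed

text \<open>
  A function on \<open>[a, b]\<close> is a total function on the reals of which only the values on \<open>{a..b}\<close>
  matter. The space consists of functions, not of equivalence classes.
\<close>

definition bochner_L1 :: "real \<Rightarrow> real \<Rightarrow> (real \<Rightarrow> 'b::real_normed_vector) set" where
  "bochner_L1 a b =
     {f. bochner_measurable (lebesgue_on {a..b}) f \<and>
         integrable (lebesgue_on {a..b}) (\<lambda>s. norm (f s))}"

text \<open>
  For \<open>s = t\<close> the kernel \<open>(t - s) powr (\<alpha> - 1)\<close> has the value \<open>0\<close> by convention; this concerns
  only a null set.
\<close>

definition rl_integral_exists ::
    "real \<Rightarrow> real \<Rightarrow> (real \<Rightarrow> 'b::real_normed_vector) \<Rightarrow> real \<Rightarrow> bool" where
  "rl_integral_exists \<alpha> t0 f t \<longleftrightarrow>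
     strong_bochner_integrable (lebesgue_on {t0..t}) (\<lambda>s. (t - s) powr (\<alpha> - 1) *\<^sub>R f s)"

text \<open>Equal to \<open>0\<close> at those \<open>t\<close> where the integral does not exist.\<close>

definition rl_integral ::
    "real \<Rightarrow> real \<Rightarrow> (real \<Rightarrow> 'b::real_normed_vector) \<Rightarrow> real \<Rightarrow> 'b" where
  "rl_integral \<alpha> t0 f t =
     (1 / Gamma \<alpha>) *\<^sub>R
       strong_bochner_integral (lebesgue_on {t0..t}) (\<lambda>s. (t - s) powr (\<alpha> - 1) *\<^sub>R f s)"

end

theory Submission
  imports Defs
begin

text \<open>
  Write \<open>k t s = (t - s) powr (\<alpha> - 1)\<close> for \<open>t0 \<le> s \<le> t\<close>. Since \<open>X\<close> is a Banach space, a strongly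
  measurable function is Bochner integrable iff its norm has finite integral
  (\<open>strong_bochner_integrable_iff\<close>), so existence of the fractional integral at \<open>t\<close> only means that
  \<open>\<integral> k t s * norm (f s) ds\<close> is finite.

  Tonelli's theorem bounds the integral over \<open>t \<in> [t0, b]\<close> of this scalar quantity by
  \<open>(b - t0) powr \<alpha> / \<alpha>\<close> times the \<open>L\<^sup>1\<close> norm of \<open>f\<close> on \<open>[t0, b]\<close>
  (\<open>nn_integral_kernel_integral_le\<close>), whence it is finite for almost every \<open>t\<close>; exhausting
  \<open>[t0, t1)\<close> by intervals \<open>[t0, b]\<close> gives one direction of (i). For the other direction, existence
  almost everywhere gives existence at some \<open>t > b\<close>, and for such a \<open>t\<close> the kernel \<open>k t\<close> is bounded away from \<open>0\<close> on
  \<open>[t0, b]\<close>, so that integrability of \<open>k t s *\<^sub>R f s\<close> passes to \<open>f\<close>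
  (\<open>strong_bochner_integrable_if_rl_integral_exists\<close>).

  In (ii) the bound on the norm again comes from Tonelli, and the point is that the fractional integral
  is strongly measurable in \<open>t\<close>. For a simple function it is almost everywhere a finite sum of
  measurable scalar functions times constant vectors. A general \<open>f\<close> is an \<open>L\<^sup>1\<close> limit of simple
  functions \<open>v n\<close>; the difference of the fractional integrals of \<open>f\<close> and \<open>v n\<close> is dominated by the
  scalar fractional integral of \<open>norm (f s - v n s)\<close>, which tends to \<open>0\<close> in \<open>L\<^sup>1\<close>, and strong
  measurability survives such a dominated limit (\<open>bochner_measurable_L1_limit\<close>).
\<close>

section \<open>Strong measurability and strong integrability\<close>

text \<open>
  The measure need not be complete, so the norm of a strongly measurable function is only almost everywhere
  equal to a measurable function.
\<close>

lemma bochner_measurable_norm: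
  assumes "bochner_measurable M f"
  obtains h where "h \<in> borel_measurable M" "AE x in M. ennreal (norm (f x)) = h x"
  using bochner_measurable_norm_diff[OF assms, of "\<lambda>_. 0"] by auto

lemma simple_function_imp_bochner_measurable:
  "simple_function M f \<Longrightarrow> bochner_measurable M f"
  unfolding bochner_measurable_def by (intro exI[of _ "\<lambda>_. f"]) simp

lemma bochner_measurable_cong_AE:
  assumes "bochner_measurable M f" "AE x in M. f x = g x"
  shows "bochner_measurable M g"
proof -
  obtain s where s: "\<And>i. simple_function M (s i)" "AE x in M. (\<lambda>i. s i x) \<longlonglongrightarrow> f x"
    using assms(1) unfolding bochner_measurable_def by blast
  have "AE x in M. (\<lambda>i. s i x) \<longlonglongrightarrow> g x"
    using s(2) assms(2) by eventually_elim simp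
  then show ?thesis
    using s(1) unfolding bochner_measurable_def by blast
qed

lemma bochner_measurable_add:
  assumes "bochner_measurable M f" "bochner_measurable M g"
  shows "bochner_measurable M (\<lambda>x. f x + g x)"
proof -
  obtain s where s: "\<And>i. simple_function M (s i)" "AE x in M. (\<lambda>i. s i x) \<longlonglongrightarrow> f x"
    using assms(1) unfolding bochner_measurable_def by blast
  obtain t where t: "\<And>i. simple_function M (t i)" "AE x in M. (\<lambda>i. t i x) \<longlonglongrightarrow> g x"
    using assms(2) unfolding bochner_measurable_def by blast
  have "AE x in M. (\<lambda>i. s i x + t i x) \<longlonglongrightarrow> f x + g x"
    using s(2) t(2) by eventually_elim (rule tendsto_add)
  moreover have "simple_function M (\<lambda>x. s i x + t i x)" for i
    by (rule simple_function_compose2[OF s(1) t(1)])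
  ultimately show ?thesis
    unfolding bochner_measurable_def by (intro exI[of _ "\<lambda>i x. s i x + t i x"]) auto
qed

lemma bochner_measurable_scaleR:
  fixes r :: "'a \<Rightarrow> real"
  assumes "r \<in> borel_measurable M" "bochner_measurable M f"
  shows "bochner_measurable M (\<lambda>x. r x *\<^sub>R f x)"
proof -
  obtain s where s: "\<And>i. simple_function M (s i)" "AE x in M. (\<lambda>i. s i x) \<longlonglongrightarrow> f x"
    using assms(2) unfolding bochner_measurable_def by blast
  obtain q where q: "\<And>i. simple_function M (q i)" "\<And>x. x \<in> space M \<Longrightarrow> (\<lambda>i. q i x) \<longlonglongrightarrow> r x"
    using borel_measurable_implies_sequence_metric[OF assms(1), of 0] by metis
  have "AE x in M. (\<lambda>i. q i x *\<^sub>R s i x) \<longlonglongrightarrow> r x *\<^sub>R f x"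
    using s(2) AE_space by eventually_elim (intro tendsto_scaleR q)
  moreover have "simple_function M (\<lambda>x. q i x *\<^sub>R s i x)" for i
    by (rule simple_function_compose2[OF q(1) s(1)])
  ultimately show ?thesis
    unfolding bochner_measurable_def by (intro exI[of _ "\<lambda>i x. q i x *\<^sub>R s i x"]) auto
qed

lemma bochner_measurable_diff:
  assumes "bochner_measurable M f" "bochner_measurable M g"
  shows "bochner_measurable M (\<lambda>x. f x - g x)"
  using bochner_measurable_add[OF assms(1) bochner_measurable_scaleR[OF _ assms(2), of "\<lambda>_. -1"]]
  by simp

lemma bochner_measurable_sum:
  assumes "\<And>i. i \<in> I \<Longrightarrow> bochner_measurable M (f i)"
  shows "bochner_measurable M (\<lambda>x. \<Sum>i\<in>I. f i x)"
  using assms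
proof (induction I rule: infinite_finite_induct)
  case (insert i I)
  then show ?case
    using bochner_measurable_add[of M "f i"] by simp
qed (simp_all add: simple_function_imp_bochner_measurable)

text \<open>
  Additivity of the nonnegative integral needs measurable integrands; it is available for the measurable
  representatives of the two norms.
\<close>

lemma nn_integral_norm_triangle:
  assumes f: "bochner_measurable M f" and g: "bochner_measurable M g"
  shows "(\<integral>\<^sup>+x. norm (f x + g x) \<partial>M) \<le> (\<integral>\<^sup>+x. norm (f x) \<partial>M) + (\<integral>\<^sup>+x. norm (g x) \<partial>M)"
proof -
  obtain a where a: "a \<in> borel_measurable M" "AE x in M. ennreal (norm (f x)) = a x"
    using bochner_measurable_norm[OF f] .
  obtain b where b: "b \<in> borel_measurable M" "AE x in M. ennreal (norm (g x)) = b x"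
    using bochner_measurable_norm[OF g] .
  have "(\<integral>\<^sup>+x. norm (f x + g x) \<partial>M) \<le> (\<integral>\<^sup>+x. a x + b x \<partial>M)"
    using a(2) b(2)
  proof (intro nn_integral_mono_AE, eventually_elim)
    case (elim x)
    have "ennreal (norm (f x + g x)) \<le> ennreal (norm (f x) + norm (g x))"
      by (intro ennreal_leI norm_triangle_ineq)
    also have "\<dots> = a x + b x"
      unfolding elim(3,4)[symmetric] by (rule ennreal_plus) auto
    finally show ?case .
  qed
  also have "\<dots> = (\<integral>\<^sup>+x. a x \<partial>M) + (\<integral>\<^sup>+x. b x \<partial>M)"
    by (rule nn_integral_add[OF a(1) b(1)])
  also have "\<dots> = (\<integral>\<^sup>+x. norm (f x) \<partial>M) + (\<integral>\<^sup>+x. norm (g x) \<partial>M)"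
    using nn_integral_cong_AE[OF a(2)] nn_integral_cong_AE[OF b(2)] by simp
  finally show ?thesis .
qed

lemma nn_integral_norm_diff_triangle:
  assumes "bochner_measurable M f" "bochner_measurable M g" "bochner_measurable M h"
  shows "(\<integral>\<^sup>+x. norm (f x - h x) \<partial>M) \<le> (\<integral>\<^sup>+x. norm (f x - g x) \<partial>M) + (\<integral>\<^sup>+x. norm (g x - h x) \<partial>M)"
  using nn_integral_norm_triangle[OF bochner_measurable_diff[OF assms(1,2)]
      bochner_measurable_diff[OF assms(2,3)]]
  by simp

lemma simple_bochner_integrableD:
  assumes "Bochner_Integration.simple_bochner_integrable M s"
  shows "simple_function M s" "bochner_measurable M s"
  using assms by (auto elim: simple_bochner_integrable.cases intro: simple_function_imp_bochner_measurable)

lemma has_strong_bochner_integral_cong_AE: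
  assumes "has_strong_bochner_integral M f y" "AE x in M. f x = g x"
  shows "has_strong_bochner_integral M g y"
proof -
  have "(\<integral>\<^sup>+x. ennreal (norm (f x - s x)) \<partial>M) = (\<integral>\<^sup>+x. ennreal (norm (g x - s x)) \<partial>M)" for s
    using assms(2) by (intro nn_integral_cong_AE) auto
  then show ?thesis
    using assms bochner_measurable_cong_AE unfolding has_strong_bochner_integral_def by auto
qed

lemma has_strong_bochner_integral_add:
  assumes "has_strong_bochner_integral M f y" "has_strong_bochner_integral M g z"
  shows "has_strong_bochner_integral M (\<lambda>x. f x + g x) (y + z)"
proof -
  obtain s where s: "\<And>i. Bochner_Integration.simple_bochner_integrable M (s i)"
      "(\<lambda>i. \<integral>\<^sup>+x. ennreal (norm (f x - s i x)) \<partial>M) \<longlonglongrightarrow> 0"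
      "(\<lambda>i. Bochner_Integration.simple_bochner_integral M (s i)) \<longlonglongrightarrow> y"
      and f: "bochner_measurable M f"
    using assms(1) unfolding has_strong_bochner_integral_def by blast
  obtain t where t: "\<And>i. Bochner_Integration.simple_bochner_integrable M (t i)"
      "(\<lambda>i. \<integral>\<^sup>+x. ennreal (norm (g x - t i x)) \<partial>M) \<longlonglongrightarrow> 0"
      "(\<lambda>i. Bochner_Integration.simple_bochner_integral M (t i)) \<longlonglongrightarrow> z"
      and g: "bochner_measurable M g"
    using assms(2) unfolding has_strong_bochner_integral_def by blast
  have "Bochner_Integration.simple_bochner_integrable M (\<lambda>x. s i x + t i x)" for i
    by (rule simple_bochner_integrable_compose2[OF _ s(1) t(1)]) simp
  moreover have "(\<lambda>i. \<integral>\<^sup>+x. ennreal (norm ((f x + g x) - (s i x + t i x))) \<partial>M) \<longlonglongrightarrow> 0"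
  proof (rule tendsto_sandwich[OF _ _ tendsto_const])
    show "\<forall>\<^sub>F i in sequentially. (\<integral>\<^sup>+x. ennreal (norm ((f x + g x) - (s i x + t i x))) \<partial>M)
        \<le> (\<integral>\<^sup>+x. ennreal (norm (f x - s i x)) \<partial>M) + (\<integral>\<^sup>+x. ennreal (norm (g x - t i x)) \<partial>M)"
      using nn_integral_norm_triangle[OF bochner_measurable_diff[OF f simple_bochner_integrableD(2)[OF s(1)]]
         bochner_measurable_diff[OF g simple_bochner_integrableD(2)[OF t(1)]]]
      by (intro always_eventually allI) (simp add: add_diff_add)
    show "(\<lambda>i. (\<integral>\<^sup>+x. ennreal (norm (f x - s i x)) \<partial>M) + (\<integral>\<^sup>+x. ennreal (norm (g x - t i x)) \<partial>M)) \<longlonglongrightarrow> 0"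
      using tendsto_add[OF s(2) t(2)] by simp
  qed simp
  moreover have "(\<lambda>i. Bochner_Integration.simple_bochner_integral M (\<lambda>x. s i x + t i x)) \<longlonglongrightarrow> y + z"
    using tendsto_add[OF s(3) t(3)] s(1) t(1) by (simp add: simple_bochner_integral_add)
  ultimately show ?thesis
    unfolding has_strong_bochner_integral_def
    by (intro conjI bochner_measurable_add[OF f g] exI[of _ "\<lambda>i x. s i x + t i x"]) auto
qed

lemma has_strong_bochner_integral_zero: "has_strong_bochner_integral M (\<lambda>_. 0) 0"
proof -
  have "Bochner_Integration.simple_bochner_integrable M (\<lambda>_. 0)"
    by (auto intro: simple_bochner_integrable.intros)
  then show ?thesis
  unfolding has_strong_bochner_integral_def
  by (auto intro!: simple_function_imp_bochner_measurable exI[of _ "\<lambda>_ _. 0"]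
      simp: simple_bochner_integral_def image_constant_conv)
qed

lemma has_strong_bochner_integral_sum:
  assumes "\<And>i. i \<in> I \<Longrightarrow> has_strong_bochner_integral M (f i) (y i)"
  shows "has_strong_bochner_integral M (\<lambda>x. \<Sum>i\<in>I. f i x) (\<Sum>i\<in>I. y i)"
  using assms
proof (induction I rule: infinite_finite_induct)
  case (insert i I)
  then show ?case
    using has_strong_bochner_integral_add[of M "f i" "y i"] by simp
qed (simp_all add: has_strong_bochner_integral_zero)

text \<open>
  The map \<open>a \<mapsto> a *\<^sub>R v\<close> sends approximating simple scalar functions to approximating simple vector-valued
  functions. This links fractional integrals of simple functions to scalar integrals.
\<close>

lemma has_strong_bochner_integral_scaleR_left:
  fixes r :: "'a \<Rightarrow> real"
  assumes "has_bochner_integral M r c"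
  shows "has_strong_bochner_integral M (\<lambda>x. r x *\<^sub>R v) (c *\<^sub>R v)"
proof -
  have r: "r \<in> borel_measurable M" and "has_strong_bochner_integral M r c"
    using assms has_bochner_integral_iff_strong by blast+
  then obtain s where s: "\<And>i. Bochner_Integration.simple_bochner_integrable M (s i)"
      "(\<lambda>i. \<integral>\<^sup>+x. ennreal (norm (r x - s i x)) \<partial>M) \<longlonglongrightarrow> 0"
      "(\<lambda>i. Bochner_Integration.simple_bochner_integral M (s i)) \<longlonglongrightarrow> c"
    unfolding has_strong_bochner_integral_def by blast
  have [measurable]: "s i \<in> borel_measurable M" for i
    by (rule borel_measurable_simple_function[OF simple_bochner_integrableD(1)[OF s(1)]])
  have "Bochner_Integration.simple_bochner_integrable M (\<lambda>x. s i x *\<^sub>R v)" for i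
    using simple_bochner_integrable_compose2[where p="\<lambda>a _. a *\<^sub>R v", OF _ s(1) s(1)] by simp
  moreover have "(\<lambda>i. \<integral>\<^sup>+x. ennreal (norm (r x *\<^sub>R v - s i x *\<^sub>R v)) \<partial>M) \<longlonglongrightarrow> 0"
  proof -
    have "(\<integral>\<^sup>+x. ennreal (norm (r x *\<^sub>R v - s i x *\<^sub>R v)) \<partial>M) =
        ennreal (norm v) * (\<integral>\<^sup>+x. ennreal (norm (r x - s i x)) \<partial>M)" for i
      using r by (subst nn_integral_cmult[symmetric])
         (auto simp: ennreal_mult[symmetric] mult.commute simp flip: scaleR_left_diff_distrib)
    then show ?thesis
      using ennreal_tendsto_cmult[OF _ s(2), of "ennreal (norm v)"] by simp
  qed
  moreover have "(\<lambda>i. Bochner_Integration.simple_bochner_integral M (\<lambda>x. s i x *\<^sub>R v)) \<longlonglongrightarrow> c *\<^sub>R v"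
    using tendsto_scaleR[OF s(3) tendsto_const[of v]]
      simple_bochner_integral_linear[OF linear_scaleR_left[of v] s(1)] by simp
  ultimately show ?thesis
    unfolding has_strong_bochner_integral_def
    by (intro conjI bochner_measurable_scaleR[OF r] exI[of _ "\<lambda>i x. s i x *\<^sub>R v"])
     (auto intro: simple_function_imp_bochner_measurable)
qed

text \<open>
  The inequality holds for the approximating simple functions, up to their distances to \<open>f\<close> and \<open>g\<close>,
  and those distances vanish in the limit.
\<close>

lemma has_strong_bochner_integral_norm_diff_le:
  assumes "has_strong_bochner_integral M f y" "has_strong_bochner_integral M g z"
  shows "ennreal (norm (y - z)) \<le> (\<integral>\<^sup>+x. norm (f x - g x) \<partial>M)"
proof -
  obtain s where s: "\<And>i. Bochner_Integration.simple_bochner_integrable M (s i)"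
      "(\<lambda>i. \<integral>\<^sup>+x. ennreal (norm (f x - s i x)) \<partial>M) \<longlonglongrightarrow> 0"
      "(\<lambda>i. Bochner_Integration.simple_bochner_integral M (s i)) \<longlonglongrightarrow> y"
      and f: "bochner_measurable M f"
    using assms(1) unfolding has_strong_bochner_integral_def by blast
  obtain t where t: "\<And>i. Bochner_Integration.simple_bochner_integrable M (t i)"
      "(\<lambda>i. \<integral>\<^sup>+x. ennreal (norm (g x - t i x)) \<partial>M) \<longlonglongrightarrow> 0"
      "(\<lambda>i. Bochner_Integration.simple_bochner_integral M (t i)) \<longlonglongrightarrow> z"
      and g: "bochner_measurable M g"
    using assms(2) unfolding has_strong_bochner_integral_def by blast
  let ?b = "\<lambda>i. (\<integral>\<^sup>+x. norm (f x - s i x) \<partial>M) + ((\<integral>\<^sup>+x. norm (f x - g x) \<partial>M) + (\<integral>\<^sup>+x. norm (g x - t i x) \<partial>M))"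
  show ?thesis
  proof (rule LIMSEQ_le)
    show "(\<lambda>i. ennreal (norm (Bochner_Integration.simple_bochner_integral M (s i) -
        Bochner_Integration.simple_bochner_integral M (t i)))) \<longlonglongrightarrow> ennreal (norm (y - z))"
      by (intro tendsto_ennrealI tendsto_intros s t)
    show "?b \<longlonglongrightarrow> (\<integral>\<^sup>+x. norm (f x - g x) \<partial>M)"
      using tendsto_add[OF s(2) tendsto_add[OF tendsto_const t(2)]] by simp
    have "ennreal (norm (Bochner_Integration.simple_bochner_integral M (s i) -
        Bochner_Integration.simple_bochner_integral M (t i))) \<le> ?b i" for i
      by (rule order_trans[OF simple_bochner_integral_strong_bounded[OF f s(1) t(1)]])
         (intro add_left_mono nn_integral_norm_diff_triangle f g simple_bochner_integrableD(2)[OF t(1)])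
    then show "\<exists>N. \<forall>n\<ge>N. ennreal (norm (Bochner_Integration.simple_bochner_integral M (s n) -
        Bochner_Integration.simple_bochner_integral M (t n))) \<le> ?b n"
      by blast
  qed
qed

text \<open>
  Along a selection of indices for which the integrals are below \<open>(1/2) ^ k\<close>, the sum of the functions
  has finite integral, hence is finite almost everywhere, and the terms of a convergent series tend to \<open>0\<close>.
  The selected indices need not increase.
\<close>

lemma tendsto_0_nn_integral_AE_subseq:
  fixes d :: "nat \<Rightarrow> 'a \<Rightarrow> ennreal"
  assumes [measurable]: "\<And>n. d n \<in> borel_measurable M"
    and lim: "(\<lambda>n. \<integral>\<^sup>+x. d n x \<partial>M) \<longlonglongrightarrow> 0"
  obtains r :: "nat \<Rightarrow> nat" where "AE x in M. (\<lambda>k. d (r k) x) \<longlonglongrightarrow> 0"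
proof -
  have "\<exists>n. (\<integral>\<^sup>+x. d n x \<partial>M) < ennreal ((1/2) ^ k)" for k
    using order_tendstoD(2)[OF lim, of "ennreal ((1/2)^k)"] 
    by (auto simp: eventually_sequentially)
  then obtain r where r: "\<And>k. (\<integral>\<^sup>+x. d (r k) x \<partial>M) < ennreal ((1/2) ^ k)"
    by metis
  have "(\<integral>\<^sup>+x. (\<Sum>k. d (r k) x) \<partial>M) = (\<Sum>k. \<integral>\<^sup>+x. d (r k) x \<partial>M)"
    by (rule nn_integral_suminf) measurable
  also have "\<dots> \<le> (\<Sum>k. ennreal ((1/2) ^ k))"
    using r by (intro suminf_le) (auto intro: less_imp_le)
  also have "\<dots> = ennreal (\<Sum>k. (1/2) ^ k)"
    by (intro suminf_ennreal2) auto
  finally have "(\<integral>\<^sup>+x. (\<Sum>k. d (r k) x) \<partial>M) \<noteq> \<infinity>"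
    by (auto simp: top_unique)
  then have "AE x in M. (\<Sum>k. d (r k) x) \<noteq> \<infinity>"
    by (intro nn_integral_PInf_AE) measurable
  then have "AE x in M. (\<lambda>k. d (r k) x) \<longlonglongrightarrow> 0"
  proof eventually_elim
    case (elim x)
    then have fin: "d (r k) x \<noteq> top" for k
      using ennreal_suminf_lessD[of "\<lambda>k. d (r k) x" top k] by (auto simp: less_top)
    have "(\<Sum>k. ennreal (enn2real (d (r k) x))) \<noteq> top"
      using elim fin by (simp add: less_top)
    then have "summable (\<lambda>k. enn2real (d (r k) x))"
      by (intro summable_suminf_not_top) auto
    then have "(\<lambda>k. ennreal (enn2real (d (r k) x))) \<longlonglongrightarrow> ennreal 0"
      by (intro tendsto_ennrealI summable_LIMSEQ_zero)
    then show ?case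
      using fin by (simp add: less_top)
  qed
  then show thesis by (rule that)
qed

text \<open>
  The integrals of the simple functions form a Cauchy sequence; completeness of the target supplies the
  value of the integral.
\<close>

lemma strong_bochner_integrableI_sequence:
  fixes f :: "'a \<Rightarrow> 'b::banach"
  assumes f: "bochner_measurable M f"
    and s: "\<And>n. Bochner_Integration.simple_bochner_integrable M (s n)"
    and lim: "(\<lambda>n. \<integral>\<^sup>+x. norm (f x - s n x) \<partial>M) \<longlonglongrightarrow> 0" (is "?S \<longlonglongrightarrow> 0")
  shows "strong_bochner_integrable M f"
proof -
  let ?s = "\<lambda>n. Bochner_Integration.simple_bochner_integral M (s n)"
  have "Cauchy ?s"
  proof (rule CauchyI)
    fix e :: real assume "0 < e"
    then have "0 < ennreal (e / 2)" by auto
    from order_tendstoD(2)[OF lim this] obtain N where N: "\<And>n. N \<le> n \<Longrightarrow> ?S n < ennreal (e / 2)"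
      by (auto simp: eventually_sequentially)
    show "\<exists>N. \<forall>m\<ge>N. \<forall>n\<ge>N. norm (?s m - ?s n) < e"
    proof (intro exI allI impI)
      fix m n assume mn: "N \<le> m" "N \<le> n"
      have "ennreal (norm (?s m - ?s n)) \<le> ?S m + ?S n"
        by (rule simple_bochner_integral_strong_bounded[OF f s s])
      also have "\<dots> < ennreal (e / 2) + ennreal (e / 2)"
        using N mn by (intro add_strict_mono) auto
      also have "\<dots> = ennreal e"
        using \<open>0 < e\<close> by (simp flip: ennreal_plus)
      finally show "norm (?s m - ?s n) < e"
        using \<open>0 < e\<close> by (simp add: ennreal_less_iff)
    qed
  qed
  then obtain y where "?s \<longlonglongrightarrow> y"
    using Cauchy_convergent convergent_def by metis
  then show ?thesis
    unfolding strong_bochner_integrable_def has_strong_bochner_integral_def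
    using f s lim by blast
qed

text \<open>
  Bochner's criterion. To obtain approximation in \<open>L\<^sup>1\<close> from approximation almost everywhere, the simple
  functions are cut off to \<open>0\<close> where their norm exceeds twice the norm of \<open>f\<close>. The cut-off still
  converges, because its threshold is strictly above the norm of the limit wherever \<open>f x \<noteq> 0\<close>, and it is
  dominated by an integrable function.
\<close>

lemma strong_bochner_integrable_iff:
  fixes f :: "'a \<Rightarrow> 'b::banach"
  shows "strong_bochner_integrable M f \<longleftrightarrow>
    bochner_measurable M f \<and> (\<integral>\<^sup>+x. norm (f x) \<partial>M) < \<infinity>" (is "_ \<longleftrightarrow> ?R")
proof
  assume "strong_bochner_integrable M f"
  then obtain s where f: "bochner_measurable M f"
    and s: "\<And>n. Bochner_Integration.simple_bochner_integrable M (s n)"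
    and lim: "(\<lambda>n. \<integral>\<^sup>+x. norm (f x - s n x) \<partial>M) \<longlonglongrightarrow> 0"
    unfolding strong_bochner_integrable_def has_strong_bochner_integral_def by blast
  obtain n where n: "(\<integral>\<^sup>+x. norm (f x - s n x) \<partial>M) < 1"
    using order_tendstoD(2)[OF lim, of 1] by (auto simp: eventually_sequentially)
  have "Bochner_Integration.simple_bochner_integrable M (\<lambda>x. norm (s n x))"
    using simple_bochner_integrable_compose2[where p="\<lambda>a _. norm a", OF _ s s] by simp
  then have "(\<integral>\<^sup>+x. norm (s n x) \<partial>M) < \<infinity>"
    by (subst simple_bochner_integral_eq_nn_integral[symmetric]) auto
  moreover have "(\<integral>\<^sup>+x. norm (f x) \<partial>M) \<le> (\<integral>\<^sup>+x. norm (f x - s n x) \<partial>M) + (\<integral>\<^sup>+x. norm (s n x) \<partial>M)"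
    using nn_integral_norm_triangle[OF bochner_measurable_diff[OF f simple_bochner_integrableD(2)[OF s]]
        simple_bochner_integrableD(2)[OF s], of n n]
    by simp
  ultimately show ?R
    using f n by (auto simp: less_top[symmetric] top_unique)
next
  assume R: ?R
  then obtain s where s: "\<And>i. simple_function M (s i)" "AE x in M. (\<lambda>i. s i x) \<longlonglongrightarrow> f x"
    unfolding bochner_measurable_def by blast
  obtain h where h: "h \<in> borel_measurable M" "AE x in M. ennreal (norm (f x)) = h x"
    using bochner_measurable_norm R by blast
  define t where "t = (\<lambda>i x. if ennreal (norm (s i x)) \<le> 2 * h x then s i x else 0)"
  have t: "simple_function M (t i)" for i
  proof -
    have "(\<lambda>x. ennreal (norm (s i x))) \<in> borel_measurable M"
      by (rule borel_measurable_simple_function[OF simple_function_compose1[OF s(1)]])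
    then have [measurable]: "{x\<in>space M. ennreal (norm (s i x)) \<le> 2 * h x} \<in> sets M"
      using h(1) by measurable
    show ?thesis
      unfolding t_def
      by (intro simple_function_If s simple_function_const)
         measurable
  qed
  have t_le: "ennreal (norm (t i x)) \<le> 2 * h x" for i x
    by (auto simp: t_def)
  have t_lim: "AE x in M. (\<lambda>i. t i x) \<longlonglongrightarrow> f x"
    using s(2) h(2)
  proof eventually_elim
    case (elim x)
    show ?case
    proof (cases "f x = 0")
      case True
      then have "t i x = 0" for i
        using elim(2) by (simp add: t_def flip: elim(2))
      then show ?thesis
        using True by simp
    next
      case False
      then have "\<forall>\<^sub>F i in sequentially. norm (s i x) < 2 * norm (f x)"
        by (intro order_tendstoD(2)[OF tendsto_norm[OF elim(1)]]) auto
      then have "\<forall>\<^sub>F i in sequentially. t i x = s i x"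
      proof eventually_elim
        case (elim i)
        then have "ennreal (norm (s i x)) \<le> ennreal (2 * norm (f x))"
          by (intro ennreal_leI) simp
        then show ?case
          using \<open>ennreal (norm (f x)) = h x\<close> by (simp add: t_def ennreal_mult)
      qed
      then show ?thesis
        using elim(1) by (rule tendsto_cong[THEN iffD2])
    qed
  qed
  have "\<forall>i. \<exists>d. d \<in> borel_measurable M \<and> (AE x in M. ennreal (norm (f x - t i x)) = d x)"
    by (rule allI, rule bochner_measurable_norm_diff[OF conjunct1[OF R] t]) blast
  from choice[OF this] obtain d where d: "\<And>i. d i \<in> borel_measurable M"
      "\<And>i. AE x in M. ennreal (norm (f x - t i x)) = d i x"
    by blast
  have "(\<lambda>i. \<integral>\<^sup>+x. d i x \<partial>M) \<longlonglongrightarrow> (\<integral>\<^sup>+x. 0 \<partial>M)"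
  proof (rule nn_integral_dominated_convergence[where w="\<lambda>x. 3 * h x"])
    show "AE x in M. d i x \<le> 3 * h x" for i
      using d(2)[of i] h(2)
    proof eventually_elim
      case (elim x)
      have "d i x \<le> ennreal (norm (f x) + norm (t i x))"
        unfolding elim(1)[symmetric] by (intro ennreal_leI norm_triangle_ineq4)
      also have "\<dots> = h x + ennreal (norm (t i x))"
        by (simp flip: elim(2))
      also have "\<dots> \<le> h x + 2 * h x"
        by (intro add_left_mono t_le)
      also have "\<dots> = (1 + 2) * h x"
        by (simp only: distrib_right mult_1)
      finally show ?case
        by simp
    qed
    have "(\<integral>\<^sup>+x. 3 * h x \<partial>M) = 3 * (\<integral>\<^sup>+x. norm (f x) \<partial>M)"
      by (simp only: nn_integral_cmult[OF h(1)] nn_integral_cong_AE[OF h(2)])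
    then show "(\<integral>\<^sup>+x. 3 * h x \<partial>M) < \<infinity>"
      using R by (simp add: ennreal_mult_less_top)
    have "AE x in M. \<forall>i. ennreal (norm (f x - t i x)) = d i x"
      using d(2) by (simp add: AE_all_countable)
    with t_lim show "AE x in M. (\<lambda>i. d i x) \<longlonglongrightarrow> 0"
    proof eventually_elim
      case (elim x)
      have "(\<lambda>i. ennreal (norm (f x - t i x))) \<longlonglongrightarrow> ennreal (norm (f x - f x))"
        by (intro tendsto_ennrealI tendsto_intros elim(1))
      then show ?case using elim(2) by simp
    qed
  qed (use d h in auto)
  then have lim: "(\<lambda>i. \<integral>\<^sup>+x. norm (f x - t i x) \<partial>M) \<longlonglongrightarrow> 0"
    by (simp add: nn_integral_cong_AE[OF d(2)])
  have "(\<integral>\<^sup>+x. ennreal (norm (t i x)) \<partial>M) < \<infinity>" for i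
  proof -
    have "(\<integral>\<^sup>+x. ennreal (norm (t i x)) \<partial>M) \<le> (\<integral>\<^sup>+x. 2 * h x \<partial>M)"
      by (intro nn_integral_mono t_le)
    also have "\<dots> = 2 * (\<integral>\<^sup>+x. norm (f x) \<partial>M)"
      by (simp only: nn_integral_cmult[OF h(1)] nn_integral_cong_AE[OF h(2)])
    finally show ?thesis
      using R by (auto simp: ennreal_mult_less_top intro: order.strict_trans1)
  qed
  then have "Bochner_Integration.simple_bochner_integrable M (t i)" for i
    by (intro simple_bochner_integrableI_bounded t)
  then show "strong_bochner_integrable M f"
    using R lim by (intro strong_bochner_integrableI_sequence) auto
qed

text \<open>
  Each \<open>u n\<close> is within \<open>(1/2) ^ n\<close> of a simple function \<open>s n\<close> in \<open>L\<^sup>1\<close>, so the distances from \<open>F\<close> to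
  \<open>s n\<close> are dominated by functions whose integrals tend to \<open>0\<close>, and suitable \<open>s n\<close> converge to \<open>F\<close> almost
  everywhere. The measurable majorants \<open>e n\<close> are needed because nothing is known beforehand about the
  measurability of \<open>F\<close>.
\<close>

lemma bochner_measurable_L1_limit:
  fixes F :: "'a \<Rightarrow> 'b::banach"
  assumes u: "\<And>n. strong_bochner_integrable M (u n)"
    and [measurable]: "\<And>n. e n \<in> borel_measurable M"
    and le: "\<And>n. AE x in M. ennreal (norm (F x - u n x)) \<le> e n x"
    and lim: "(\<lambda>n. \<integral>\<^sup>+x. e n x \<partial>M) \<longlonglongrightarrow> 0"
  shows "bochner_measurable M F"
proof -
  have "\<exists>s. simple_function M s \<and> (\<integral>\<^sup>+x. norm (u n x - s x) \<partial>M) < ennreal ((1/2)^n)" for n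
  proof -
    obtain s where s: "\<And>k. Bochner_Integration.simple_bochner_integrable M (s k)"
      and "(\<lambda>k. \<integral>\<^sup>+x. norm (u n x - s k x) \<partial>M) \<longlonglongrightarrow> 0"
      using u[of n] unfolding strong_bochner_integrable_def has_strong_bochner_integral_def by blast
    from order_tendstoD(2)[OF this(2), of "ennreal ((1/2)^n)"]
    obtain k where "(\<integral>\<^sup>+x. norm (u n x - s k x) \<partial>M) < ennreal ((1/2)^n)"
      by (auto simp: eventually_sequentially)
    then show ?thesis
      using simple_bochner_integrableD(1)[OF s] by blast
  qed
  then have "\<forall>n. \<exists>s. simple_function M s \<and> (\<integral>\<^sup>+x. norm (u n x - s x) \<partial>M) < ennreal ((1/2)^n)"
    by blast
  from choice[OF this] obtain s where s: "\<And>n. simple_function M (s n)"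
      "\<And>n. (\<integral>\<^sup>+x. norm (u n x - s n x) \<partial>M) < ennreal ((1/2)^n)"
    by blast
  have "\<forall>n. \<exists>d. d \<in> borel_measurable M \<and> (AE x in M. ennreal (norm (u n x - s n x)) = d x)"
    by (rule allI, rule bochner_measurable_norm_diff[OF _ s(1)])
      (use u strong_bochner_integrable_iff in blast)+
  from choice[OF this] obtain d where d[measurable]: "\<And>n. d n \<in> borel_measurable M"
      and d_eq: "\<And>n. AE x in M. ennreal (norm (u n x - s n x)) = d n x"
    by blast
  have "(\<lambda>n. ennreal ((1/2)^n)) \<longlonglongrightarrow> ennreal 0"
    by (intro tendsto_ennrealI LIMSEQ_power_zero) simp
  then have "(\<lambda>n. ennreal ((1/2)^n)) \<longlonglongrightarrow> 0"
    by simp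
  then have d_lim: "(\<lambda>n. \<integral>\<^sup>+x. d n x \<partial>M) \<longlonglongrightarrow> 0"
  proof (rule tendsto_sandwich[rotated 3])
    show "\<forall>\<^sub>F n in sequentially. (\<integral>\<^sup>+x. d n x \<partial>M) \<le> ennreal ((1/2)^n)"
      using s(2) by (auto simp: nn_integral_cong_AE[OF d_eq, symmetric] intro!: always_eventually less_imp_le)
  qed auto
  have "(\<lambda>n. \<integral>\<^sup>+x. e n x + d n x \<partial>M) \<longlonglongrightarrow> 0"
    using tendsto_add[OF lim d_lim] by (simp add: nn_integral_add)
  then obtain r where r: "AE x in M. (\<lambda>k. e (r k) x + d (r k) x) \<longlonglongrightarrow> 0"
    by (rule tendsto_0_nn_integral_AE_subseq[rotated]) measurable
  have "AE x in M. \<forall>n. ennreal (norm (u n x - s n x)) = d n x"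
    "AE x in M. \<forall>n. ennreal (norm (F x - u n x)) \<le> e n x"
    using d_eq le by (simp_all add: AE_all_countable)
  with r have "AE x in M. (\<lambda>k. s (r k) x) \<longlonglongrightarrow> F x"
  proof eventually_elim
    case (elim x)
    have "ennreal (norm (s n x - F x)) \<le> e n x + d n x" for n
    proof -
      have "ennreal (norm (s n x - F x)) \<le> ennreal (norm (F x - u n x) + norm (u n x - s n x))"
        using norm_triangle_ineq[of "F x - u n x" "u n x - s n x"]
        by (intro ennreal_leI) (simp add: norm_minus_commute)
      also have "\<dots> \<le> e n x + d n x"
        using elim(2,3) by (auto intro!: add_mono)
      finally show ?thesis .
    qed
    then have "(\<lambda>k. ennreal (norm (s (r k) x - F x))) \<longlonglongrightarrow> 0"
      by (intro tendsto_sandwich[OF _ _ tendsto_const elim(1)]) (auto intro: always_eventually)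
    then have "(\<lambda>k. norm (s (r k) x - F x)) \<longlonglongrightarrow> 0"
      by (simp flip: ennreal_0)
    then show ?case
      using LIM_zero_cancel tendsto_norm_zero_iff by blast
  qed
  then show ?thesis
    unfolding bochner_measurable_def using s(1) by (intro exI[of _ "\<lambda>k. s (r k)"]) auto
qed

section \<open>Functions on compact intervals\<close>

text \<open>
  Lebesgue measure is complete, so here almost everywhere equality to a measurable function suffices.
\<close>

lemma borel_measurable_norm_lebesgue_on:
  fixes f :: "real \<Rightarrow> 'b::real_normed_vector"
  assumes f: "bochner_measurable (lebesgue_on S) f" and S: "S \<in> sets lebesgue"
  shows "(\<lambda>x. norm (f x)) \<in> borel_measurable (lebesgue_on S)"
proof -
  obtain h where [measurable]: "h \<in> borel_measurable (lebesgue_on S)"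
    and h: "AE x in lebesgue_on S. ennreal (norm (f x)) = h x"
    using bochner_measurable_norm[OF f] .
  have S': "S \<inter> space lebesgue \<in> sets lebesgue"
    using S by simp
  have "AE x in lebesgue. x \<in> S \<longrightarrow> ennreal (norm (f x)) = h x"
    using h unfolding AE_restrict_space_iff[OF S'] .
  then have "AE x in lebesgue. indicator S x *\<^sub>R enn2real (h x) = indicator S x *\<^sub>R norm (f x)"
  proof eventually_elim
    case (elim x)
    then show ?case
      by (cases "x \<in> S") (auto simp flip: elim)
  qed
  moreover have "(\<lambda>x. indicator S x *\<^sub>R enn2real (h x)) \<in> borel_measurable lebesgue"
    by (subst borel_measurable_restrict_space_iff[OF S', symmetric]) measurable
  ultimately show ?thesis
    by (subst borel_measurable_restrict_space_iff[OF S']) (rule borel_measurable_AE)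
qed

lemma bochner_L1_iff_strong_bochner_integrable:
  fixes f :: "real \<Rightarrow> 'b::banach"
  shows "f \<in> bochner_L1 a b \<longleftrightarrow> strong_bochner_integrable (lebesgue_on {a..b}) f"
  using borel_measurable_norm_lebesgue_on[of "{a..b}" f]
  by (auto simp: bochner_L1_def strong_bochner_integrable_iff integrable_iff_bounded)

lemma bochner_measurable_lebesgue_on_subset:
  fixes f :: "real \<Rightarrow> 'b::real_normed_vector"
  assumes f: "bochner_measurable (lebesgue_on S) f"
    and S: "S \<in> sets lebesgue" and T: "T \<in> sets lebesgue" "T \<subseteq> S"
  shows "bochner_measurable (lebesgue_on T) f"
proof -
  obtain s where s: "\<And>i. simple_function (lebesgue_on S) (s i)"
    "AE x in lebesgue_on S. (\<lambda>i. s i x) \<longlonglongrightarrow> f x"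
    using f unfolding bochner_measurable_def by blast
  have "simple_function lebesgue (\<lambda>x. indicator T x *\<^sub>R (indicator S x *\<^sub>R s i x))" for i
    using S s(1)[of i]
    by (intro simple_function_compose2[where h="\<lambda>a b. a *\<^sub>R b", OF simple_function_indicator[OF T(1)]])
       (simp add: simple_function_restrict_space)
  also have "(\<lambda>x. indicator T x *\<^sub>R (indicator S x *\<^sub>R s i x)) = (\<lambda>x. indicator T x *\<^sub>R s i x)" for i
    using T(2) by (intro ext) (auto split: split_indicator)
  finally have "simple_function (lebesgue_on T) (s i)" for i
    using T(1) by (simp add: simple_function_restrict_space)
  moreover have "AE x in lebesgue_on T. (\<lambda>i. s i x) \<longlonglongrightarrow> f x"
    using s(2) S T by (auto simp: AE_restrict_space_iff)
  ultimately show ?thesis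
    unfolding bochner_measurable_def by blast
qed

lemma nn_integral_lebesgue_on_mono_set:
  assumes "S \<in> sets lebesgue" "T \<in> sets lebesgue" "T \<subseteq> S"
  shows "(\<integral>\<^sup>+x. h x \<partial>lebesgue_on T) \<le> (\<integral>\<^sup>+x. h x \<partial>lebesgue_on S)"
  using assms
  by (auto simp: nn_integral_restrict_space intro!: nn_integral_mono split: split_indicator)

text \<open>
  The intervals \<open>[a, b n]\<close> with \<open>b n\<close> tending to \<open>c\<close> from the left are countably many and miss only the
  null set \<open>{c}\<close>.
\<close>

lemma AE_lebesgue_on_Icc_exhaust:
  fixes a c :: real
  assumes "\<And>b. a < b \<Longrightarrow> b < c \<Longrightarrow> AE t in lebesgue_on {a..b}. P t" and "a < c"
  shows "AE t in lebesgue_on {a..c}. P t"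
proof -
  \<comment> \<open>the denominators start at \<open>2\<close> so that already \<open>b 0\<close> lies strictly between \<open>a\<close> and \<open>c\<close>\<close>
  define b where "b n = c - (c - a) / real (Suc (Suc n))" for n :: nat
  have b: "a < b n" "b n < c" for n
  proof -
    have "(c - a) / real (Suc (Suc n)) < (c - a) / 1"
      using \<open>a < c\<close> by (intro divide_strict_left_mono) auto
    then show "a < b n" by (simp add: b_def)
    show "b n < c" using \<open>a < c\<close> by (simp add: b_def)
  qed
  have b_lim: "b \<longlonglongrightarrow> c"
    unfolding b_def
    using tendsto_diff[OF tendsto_const LIMSEQ_Suc[OF LIMSEQ_Suc[OF lim_const_over_n]]] by force
  have "AE t in lebesgue. t \<in> {a..b n} \<longrightarrow> P t" for n
    using assms(1)[OF b] by (simp add: AE_restrict_space_iff)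
  then have "AE t in lebesgue. \<forall>n. t \<in> {a..b n} \<longrightarrow> P t"
    by (subst AE_all_countable) (rule allI)
  moreover have "AE t in lebesgue. t \<noteq> c"
    by (intro AE_completion AE_lborel_singleton)
  ultimately have "AE t in lebesgue. t \<in> {a..c} \<longrightarrow> P t"
  proof eventually_elim
    case (elim t)
    show ?case
    proof
      assume t: "t \<in> {a..c}"
      then have "t < c" using elim by simp
      from order_tendstoD(1)[OF b_lim this] obtain n where "t < b n"
        by (auto simp: eventually_sequentially)
      with t have "t \<in> {a..b n}"
        by simp
      with elim(1) show "P t"
        by blast
    qed
  qed
  then show ?thesis
    by (simp add: AE_restrict_space_iff)
qed

lemma AE_lebesgue_on_Icc_witness:
  fixes a b c :: real
  assumes "AE t in lebesgue_on {a..c}. P t" "a \<le> b" "b < c"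
  obtains t where "b < t" "t \<le> c" "P t"
proof -
  have "\<exists>t. b < t \<and> t \<le> c \<and> P t"
  proof (rule ccontr)
    assume neg: "\<not> ?thesis"
    have "AE t in lebesgue. t \<in> {a..c} \<longrightarrow> P t"
      using assms(1) by (simp add: AE_restrict_space_iff)
    then have "AE t in lebesgue. t \<notin> {b<..c}"
    proof eventually_elim
      case (elim t)
      then show ?case
        using neg assms(2) by auto
    qed
    then have "{b<..c} \<in> null_sets lebesgue"
      by (simp add: AE_iff_null_sets)
    then have "emeasure lebesgue {b<..c} = 0"
      by (rule null_setsD1)
    then show False
      using \<open>b < c\<close> by simp
  qed
  then show thesis using that by blast
qed

section \<open>The Riemann-Liouville kernel and Tonelli's theorem\<close>

text \<open>
  This is \<open>Gamma \<alpha>\<close> times the Riemann-Liouville integral of a nonnegative function; with values in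
  \<open>ennreal\<close> it is defined for all \<open>t\<close>.
\<close>

definition kernel_integral :: "real \<Rightarrow> real \<Rightarrow> (real \<Rightarrow> ennreal) \<Rightarrow> real \<Rightarrow> ennreal" where
  "kernel_integral \<alpha> t0 \<phi> t =
     (\<integral>\<^sup>+s. ennreal ((t - s) powr (\<alpha> - 1)) * \<phi> s \<partial>lebesgue_on {t0..t})"

lemma kernel_measurable_lebesgue_on:
  "(\<lambda>s. (t - s) powr \<beta>) \<in> borel_measurable (lebesgue_on S)" for t \<beta> :: real
  by (intro measurable_restrict_space1 measurable_completion) measurable

text \<open>
  Tonelli's theorem is applied to Borel measure on the plane. A Lebesgue measurable \<open>\<phi>\<close> is
  therefore replaced by a Borel function that agrees with it almost everywhere on \<open>[t0, b]\<close> and vanishes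
  almost everywhere outside, and the dependence of the domain of integration on \<open>t\<close> is moved into the
  integrand.
\<close>

lemma kernel_integral_borel_representation:
  assumes "\<phi> \<in> borel_measurable (lebesgue_on {t0..b})"
  obtains \<psi> where "\<psi> \<in> borel_measurable borel"
    "(\<integral>\<^sup>+s. \<psi> s \<partial>lborel) = (\<integral>\<^sup>+s. \<phi> s \<partial>lebesgue_on {t0..b})"
    "\<forall>t\<le>b. kernel_integral \<alpha> t0 \<phi> t =
      (\<integral>\<^sup>+s. ennreal (if t0 \<le> s \<and> s \<le> t then (t - s) powr (\<alpha> - 1) else 0) * \<psi> s \<partial>lborel)"
proof -
  have "(\<lambda>s. \<phi> s * indicator {t0..b} s) \<in> borel_measurable lebesgue"
    using assms by (simp add: borel_measurable_restrict_space_iff_ennreal)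
  from completion_ex_borel_measurable[OF this] obtain \<psi> where \<psi>: "\<psi> \<in> borel_measurable borel"
    and eq: "AE s in lborel. \<phi> s * indicator {t0..b} s = \<psi> s"
    by auto
  show thesis
  proof (rule that[OF \<psi>])
    show "(\<integral>\<^sup>+s. \<psi> s \<partial>lborel) = (\<integral>\<^sup>+s. \<phi> s \<partial>lebesgue_on {t0..b})"
      using nn_integral_cong_AE[OF eq] by (simp add: nn_integral_restrict_space nn_integral_completion)
    have "kernel_integral \<alpha> t0 \<phi> t =
        (\<integral>\<^sup>+s. ennreal (if t0 \<le> s \<and> s \<le> t then (t - s) powr (\<alpha> - 1) else 0) * \<psi> s \<partial>lborel)"
      if "t \<le> b" for t
    proof -
      have "kernel_integral \<alpha> t0 \<phi> t =
          (\<integral>\<^sup>+s. ennreal ((t - s) powr (\<alpha> - 1)) * \<phi> s * indicator {t0..t} s \<partial>lborel)"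
        by (simp add: kernel_integral_def nn_integral_restrict_space nn_integral_completion)
      also have "\<dots> = (\<integral>\<^sup>+s. ennreal (if t0 \<le> s \<and> s \<le> t then (t - s) powr (\<alpha> - 1) else 0) * \<psi> s \<partial>lborel)"
        using eq
      proof (intro nn_integral_cong_AE, eventually_elim)
        case (elim s)
        show ?case
          using elim \<open>t \<le> b\<close> by (auto split: split_indicator)
      qed
      finally show ?thesis .
    qed
    then show "\<forall>t\<le>b. kernel_integral \<alpha> t0 \<phi> t =
      (\<integral>\<^sup>+s. ennreal (if t0 \<le> s \<and> s \<le> t then (t - s) powr (\<alpha> - 1) else 0) * \<psi> s \<partial>lborel)"
      by blast
  qed
qed

lemma borel_measurable_kernel_integral:
  assumes "\<phi> \<in> borel_measurable (lebesgue_on {t0..b})"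
  shows "kernel_integral \<alpha> t0 \<phi> \<in> borel_measurable (lebesgue_on {t0..b})"
proof -
  obtain \<psi> where [measurable]: "\<psi> \<in> borel_measurable borel"
    and "(\<integral>\<^sup>+s. \<psi> s \<partial>lborel) = (\<integral>\<^sup>+s. \<phi> s \<partial>lebesgue_on {t0..b})"
    and eq: "\<forall>t\<le>b. kernel_integral \<alpha> t0 \<phi> t =
      (\<integral>\<^sup>+s. ennreal (if t0 \<le> s \<and> s \<le> t then (t - s) powr (\<alpha> - 1) else 0) * \<psi> s \<partial>lborel)"
    using kernel_integral_borel_representation[OF assms] by blast
  have "(\<lambda>t. \<integral>\<^sup>+s. ennreal (if t0 \<le> s \<and> s \<le> t then (t - s) powr (\<alpha> - 1) else 0) * \<psi> s \<partial>lborel)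
      \<in> borel_measurable lborel"
    by measurable
  then have "(\<lambda>t. \<integral>\<^sup>+s. ennreal (if t0 \<le> s \<and> s \<le> t then (t - s) powr (\<alpha> - 1) else 0) * \<psi> s \<partial>lborel)
      \<in> borel_measurable (lebesgue_on {t0..b})"
    by (intro measurable_restrict_space1 measurable_completion)
  then show ?thesis
    by (rule measurable_cong[THEN iffD1, rotated]) (simp add: eq)
qed

text \<open>
  The substitution \<open>t = s + u\<close> turns the left-hand side into the integral of \<open>u powr (\<alpha> - 1)\<close> over
  \<open>[0, b - s]\<close>; the bound by \<open>c\<close> makes the estimate uniform in \<open>s\<close>.
\<close>

lemma nn_integral_kernel_le:
  fixes s b c \<alpha> :: real
  assumes "0 < \<alpha>" "b - s \<le> c" "0 \<le> c"
  shows "(\<integral>\<^sup>+t. ennreal (if s \<le> t \<and> t \<le> b then (t - s) powr (\<alpha> - 1) else 0) \<partial>lborel)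
    \<le> ennreal (c powr \<alpha> / \<alpha>)"
proof -
  have "(\<integral>\<^sup>+t. ennreal (if s \<le> t \<and> t \<le> b then (t - s) powr (\<alpha> - 1) else 0) \<partial>lborel) =
      (\<integral>\<^sup>+u. ennreal (if s \<le> s + u \<and> s + u \<le> b then (s + u - s) powr (\<alpha> - 1) else 0) \<partial>lborel)"
    by (subst nn_integral_real_affine[where c=1 and t=s]) (simp_all cong: if_cong)
  also have "\<dots> \<le> (\<integral>\<^sup>+u. ennreal (if u \<in> {0..c} then u powr (\<alpha> - 1) else 0) \<partial>lborel)"
    using assms(2) by (intro nn_integral_mono) auto
  also have "\<dots> = ennreal (c powr \<alpha> / \<alpha>)"
  proof (rule nn_integral_has_integral_lborel)
    show "((\<lambda>u. if u \<in> {0..c} then u powr (\<alpha> - 1) else 0) has_integral c powr \<alpha> / \<alpha>) UNIV"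
      using has_integral_powr_from_0[of "\<alpha> - 1" c] assms
      by (subst has_integral_restrict_UNIV) simp
  qed auto
  finally show ?thesis .
qed

text \<open>
  After exchanging the order of integration by Tonelli, the inner integral over \<open>t\<close> is at most the
  constant, whatever \<open>s\<close> is.
\<close>

lemma nn_integral_kernel_integral_le:
  assumes \<phi>: "\<phi> \<in> borel_measurable (lebesgue_on {t0..b})" and "0 < \<alpha>" "t0 \<le> b"
  shows "(\<integral>\<^sup>+t. kernel_integral \<alpha> t0 \<phi> t \<partial>lebesgue_on {t0..b})
    \<le> ennreal ((b - t0) powr \<alpha> / \<alpha>) * (\<integral>\<^sup>+s. \<phi> s \<partial>lebesgue_on {t0..b})"
proof -
  obtain \<psi> where [measurable]: "\<psi> \<in> borel_measurable borel"
    and int: "(\<integral>\<^sup>+s. \<psi> s \<partial>lborel) = (\<integral>\<^sup>+s. \<phi> s \<partial>lebesgue_on {t0..b})"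
    and eq: "\<forall>t\<le>b. kernel_integral \<alpha> t0 \<phi> t =
      (\<integral>\<^sup>+s. ennreal (if t0 \<le> s \<and> s \<le> t then (t - s) powr (\<alpha> - 1) else 0) * \<psi> s \<partial>lborel)"
    using kernel_integral_borel_representation[OF \<phi>] by blast
  let ?k = "\<lambda>t s. ennreal (if t0 \<le> s \<and> s \<le> t then (t - s) powr (\<alpha> - 1) else 0)"
  let ?C = "ennreal ((b - t0) powr \<alpha> / \<alpha>)"
  have "(\<integral>\<^sup>+t. kernel_integral \<alpha> t0 \<phi> t \<partial>lebesgue_on {t0..b}) =
      (\<integral>\<^sup>+t. kernel_integral \<alpha> t0 \<phi> t * indicator {t0..b} t \<partial>lborel)"
    by (simp add: nn_integral_restrict_space nn_integral_completion)
  also have "\<dots> = (\<integral>\<^sup>+t. (\<integral>\<^sup>+s. ?k t s * \<psi> s \<partial>lborel) * indicator {t0..b} t \<partial>lborel)"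
    by (intro nn_integral_cong) (auto simp: eq split: split_indicator)
  also have "\<dots> = (\<integral>\<^sup>+t. (\<integral>\<^sup>+s. ?k t s * \<psi> s * indicator {t0..b} t \<partial>lborel) \<partial>lborel)"
    by (intro nn_integral_cong nn_integral_multc[symmetric]) measurable
  also have "\<dots> = (\<integral>\<^sup>+s. (\<integral>\<^sup>+t. ?k t s * \<psi> s * indicator {t0..b} t \<partial>lborel) \<partial>lborel)"
    by (rule lborel_pair.Fubini') measurable
  also have "\<dots> \<le> (\<integral>\<^sup>+s. ?C * \<psi> s \<partial>lborel)"
  proof (intro nn_integral_mono)
    fix s :: real
    have "(\<integral>\<^sup>+t. ?k t s * \<psi> s * indicator {t0..b} t \<partial>lborel)
        = (\<integral>\<^sup>+t. ?k t s * indicator {t0..b} t \<partial>lborel) * \<psi> s"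
      by (subst nn_integral_multc[symmetric]) (auto simp: ac_simps)
    also have "(\<integral>\<^sup>+t. ?k t s * indicator {t0..b} t \<partial>lborel) \<le> ?C"
    proof (cases "t0 \<le> s")
      case True
      have "(\<integral>\<^sup>+t. ?k t s * indicator {t0..b} t \<partial>lborel) \<le>
          (\<integral>\<^sup>+t. ennreal (if s \<le> t \<and> t \<le> b then (t - s) powr (\<alpha> - 1) else 0) \<partial>lborel)"
        by (intro nn_integral_mono) (auto split: split_indicator)
      also have "\<dots> \<le> ?C"
        using True assms by (intro nn_integral_kernel_le) auto
      finally show ?thesis .
    qed simp
    finally show "(\<integral>\<^sup>+t. ?k t s * \<psi> s * indicator {t0..b} t \<partial>lborel) \<le> ?C * \<psi> s"
      by (simp add: mult_right_mono)
  qed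
  also have "\<dots> = ?C * (\<integral>\<^sup>+s. \<phi> s \<partial>lebesgue_on {t0..b})"
    by (simp add: nn_integral_cmult int)
  finally show ?thesis .
qed

lemma AE_kernel_integral_finite:
  assumes \<phi>: "\<phi> \<in> borel_measurable (lebesgue_on {t0..b})" and "0 < \<alpha>" "t0 \<le> b"
    and "(\<integral>\<^sup>+s. \<phi> s \<partial>lebesgue_on {t0..b}) < \<infinity>"
  shows "AE t in lebesgue_on {t0..b}. kernel_integral \<alpha> t0 \<phi> t < \<infinity>"
proof -
  have "(\<integral>\<^sup>+t. kernel_integral \<alpha> t0 \<phi> t \<partial>lebesgue_on {t0..b}) < \<infinity>"
    by (rule order.strict_trans1[OF nn_integral_kernel_integral_le[OF assms(1-3)]])
       (use assms(4) in \<open>simp add: ennreal_mult_less_top\<close>)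
  then have "AE t in lebesgue_on {t0..b}. kernel_integral \<alpha> t0 \<phi> t \<noteq> \<infinity>"
    by (intro nn_integral_PInf_AE borel_measurable_kernel_integral[OF \<phi>]) simp
  then show ?thesis
    by (simp add: less_top)
qed

section \<open>Riemann-Liouville integrals of vector-valued functions\<close>

lemma rl_integral_exists_iff_kernel_integral_finite:
  fixes f :: "real \<Rightarrow> 'b::banach"
  assumes f: "bochner_measurable (lebesgue_on {t0..b}) f" and "t \<le> b"
  shows "rl_integral_exists \<alpha> t0 f t \<longleftrightarrow> kernel_integral \<alpha> t0 (\<lambda>s. norm (f s)) t < \<infinity>"
proof -
  have "bochner_measurable (lebesgue_on {t0..t}) f"
    using \<open>t \<le> b\<close> by (intro bochner_measurable_lebesgue_on_subset[OF f]) auto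
  then have "bochner_measurable (lebesgue_on {t0..t}) (\<lambda>s. (t - s) powr (\<alpha> - 1) *\<^sub>R f s)"
    by (rule bochner_measurable_scaleR[OF kernel_measurable_lebesgue_on])
  then show ?thesis
    by (simp add: rl_integral_exists_def strong_bochner_integrable_iff kernel_integral_def ennreal_mult)
qed

text \<open>
  The scalar integral of the kernel against the norm of \<open>f\<close> has finite integral over \<open>t\<close>, hence is finite
  almost everywhere.
\<close>

lemma AE_rl_integral_exists:
  fixes f :: "real \<Rightarrow> 'b::banach"
  assumes f: "strong_bochner_integrable (lebesgue_on {t0..b}) f" and "0 < \<alpha>" "t0 \<le> b"
  shows "AE t in lebesgue_on {t0..b}. rl_integral_exists \<alpha> t0 f t"
proof -
  have f': "bochner_measurable (lebesgue_on {t0..b}) f"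
      "(\<integral>\<^sup>+s. norm (f s) \<partial>lebesgue_on {t0..b}) < \<infinity>"
    using f by (auto simp: strong_bochner_integrable_iff)
  have [measurable]: "(\<lambda>s. norm (f s)) \<in> borel_measurable (lebesgue_on {t0..b})"
    using borel_measurable_norm_lebesgue_on[OF f'(1)] by simp
  have "AE t in lebesgue_on {t0..b}. kernel_integral \<alpha> t0 (\<lambda>s. norm (f s)) t < \<infinity>"
    using assms f'(2) by (intro AE_kernel_integral_finite) auto
  then show ?thesis
    by (rule lebesgue_on_mono) (simp add: rl_integral_exists_iff_kernel_integral_finite[OF f'(1)])
qed

text \<open>
  The reciprocal kernel \<open>(t - s) powr (1 - \<alpha>)\<close> is monotone in \<open>s\<close> and has no singularity on \<open>[t0, b]\<close>
  because \<open>b < t\<close>, so it is bounded there; multiplying the integrand by it recovers \<open>f\<close>.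
\<close>

lemma strong_bochner_integrable_if_rl_integral_exists:
  fixes f :: "real \<Rightarrow> 'b::banach"
  assumes ex: "rl_integral_exists \<alpha> t0 f t" and "t0 < b" "b < t"
  shows "strong_bochner_integrable (lebesgue_on {t0..b}) f"
proof -
  let ?M = "lebesgue_on {t0..b}"
  let ?k = "\<lambda>s. (t - s) powr (\<alpha> - 1)"
  let ?r = "\<lambda>s. (t - s) powr (1 - \<alpha>)"
  \<comment> \<open>the two summands are the values of the reciprocal kernel at the endpoints, where it is
      largest for \<open>\<alpha> \<le> 1\<close> and for \<open>\<alpha> > 1\<close> respectively\<close>
  define C where "C = (t - t0) powr (1 - \<alpha>) + (t - b) powr (1 - \<alpha>)"
  have kf: "bochner_measurable (lebesgue_on {t0..t}) (\<lambda>s. ?k s *\<^sub>R f s)"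
      "(\<integral>\<^sup>+s. norm (?k s *\<^sub>R f s) \<partial>lebesgue_on {t0..t}) < \<infinity>"
    using ex by (auto simp: rl_integral_exists_def strong_bochner_integrable_iff)
  have f_eq: "?r s *\<^sub>R (?k s *\<^sub>R f s) = f s" if "s \<in> {t0..b}" for s
    using that \<open>b < t\<close> by (simp flip: powr_add)
  have r_le: "?r s \<le> C" if "s \<in> {t0..b}" for s
  proof (cases "\<alpha> \<le> 1")
    case True
    then have "?r s \<le> (t - t0) powr (1 - \<alpha>)"
      using that \<open>b < t\<close> by (intro powr_mono2) auto
    then show ?thesis by (simp add: C_def add_increasing2)
  next
    case False
    then have "?r s \<le> (t - b) powr (1 - \<alpha>)"
      using that \<open>b < t\<close> by (intro powr_mono2') auto
    then show ?thesis by (simp add: C_def add_increasing)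
  qed
  have kf_b: "bochner_measurable ?M (\<lambda>s. ?k s *\<^sub>R f s)"
    using \<open>b < t\<close> by (intro bochner_measurable_lebesgue_on_subset[OF kf(1)]) auto
  have "bochner_measurable ?M (\<lambda>s. ?r s *\<^sub>R (?k s *\<^sub>R f s))"
    by (rule bochner_measurable_scaleR[OF kernel_measurable_lebesgue_on kf_b])
  then have "bochner_measurable ?M f"
    by (rule bochner_measurable_cong_AE) (intro AE_I2, simp only: space_lebesgue_on f_eq)
  moreover have "(\<integral>\<^sup>+s. norm (f s) \<partial>?M) < \<infinity>"
  proof -
    have [measurable]: "(\<lambda>s. norm (?k s *\<^sub>R f s)) \<in> borel_measurable ?M"
      by (rule borel_measurable_norm_lebesgue_on[OF kf_b]) simp
    have "(\<integral>\<^sup>+s. norm (f s) \<partial>?M) \<le> (\<integral>\<^sup>+s. ennreal C * ennreal (norm (?k s *\<^sub>R f s)) \<partial>?M)"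
    proof (rule nn_integral_mono)
      fix s assume "s \<in> space ?M"
      then have s: "s \<in> {t0..b}" by simp
      have "norm (f s) = ?r s * norm (?k s *\<^sub>R f s)"
        by (subst f_eq[OF s, symmetric]) (simp only: norm_scaleR abs_of_nonneg[OF powr_ge_zero])
      also have "\<dots> \<le> C * norm (?k s *\<^sub>R f s)"
        by (intro mult_right_mono r_le s) simp
      finally show "ennreal (norm (f s)) \<le> ennreal C * ennreal (norm (?k s *\<^sub>R f s))"
        by (subst ennreal_mult[symmetric]) (auto simp: C_def intro: ennreal_leI)
    qed
    also have "\<dots> = ennreal C * (\<integral>\<^sup>+s. norm (?k s *\<^sub>R f s) \<partial>?M)"
      by (rule nn_integral_cmult) measurable
    also have "\<dots> \<le> ennreal C * (\<integral>\<^sup>+s. norm (?k s *\<^sub>R f s) \<partial>lebesgue_on {t0..t})"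
      using \<open>b < t\<close> by (intro mult_left_mono nn_integral_lebesgue_on_mono_set) auto
    also have "\<dots> < \<infinity>"
      using kf(2) by (simp only: ennreal_mult_less_top infinity_ennreal_def ennreal_less_top simp_thms)
    finally show ?thesis .
  qed
  ultimately show ?thesis
    by (simp add: strong_bochner_integrable_iff)
qed

lemma norm_rl_integral_diff_le:
  fixes f g :: "real \<Rightarrow> 'b::banach"
  assumes "rl_integral_exists \<alpha> t0 f t" "rl_integral_exists \<alpha> t0 g t" and "0 < \<alpha>"
  shows "ennreal (norm (rl_integral \<alpha> t0 f t - rl_integral \<alpha> t0 g t))
    \<le> ennreal (1 / Gamma \<alpha>) * kernel_integral \<alpha> t0 (\<lambda>s. norm (f s - g s)) t"
proof -
  let ?M = "lebesgue_on {t0..t}" and ?k = "\<lambda>s. (t - s) powr (\<alpha> - 1)"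
  obtain y where y: "has_strong_bochner_integral ?M (\<lambda>s. ?k s *\<^sub>R f s) y"
    using assms(1) unfolding rl_integral_exists_def strong_bochner_integrable_def by blast
  obtain z where z: "has_strong_bochner_integral ?M (\<lambda>s. ?k s *\<^sub>R g s) z"
    using assms(2) unfolding rl_integral_exists_def strong_bochner_integrable_def by blast
  have "norm (rl_integral \<alpha> t0 f t - rl_integral \<alpha> t0 g t) = (1 / Gamma \<alpha>) * norm (y - z)"
    using \<open>0 < \<alpha>\<close> Gamma_real_pos[of \<alpha>]
    by (simp add: rl_integral_def strong_bochner_integral_eq[OF y] strong_bochner_integral_eq[OF z]
        flip: scaleR_right_diff_distrib)
  then have "ennreal (norm (rl_integral \<alpha> t0 f t - rl_integral \<alpha> t0 g t)) =
      ennreal (1 / Gamma \<alpha>) * ennreal (norm (y - z))"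
    using \<open>0 < \<alpha>\<close> Gamma_real_pos[of \<alpha>] by (simp only:) (rule ennreal_mult, auto)
  also have "ennreal (norm (y - z)) \<le> (\<integral>\<^sup>+s. norm (?k s *\<^sub>R f s - ?k s *\<^sub>R g s) \<partial>?M)"
    by (rule has_strong_bochner_integral_norm_diff_le[OF y z])
  also have "\<dots> = kernel_integral \<alpha> t0 (\<lambda>s. norm (f s - g s)) t"
    by (simp add: kernel_integral_def ennreal_mult flip: scaleR_right_diff_distrib)
  finally show ?thesis
    by (simp add: mult_left_mono)
qed

text \<open>
  Where the integral does not exist its value is \<open>0\<close>, so the estimate holds at every \<open>t\<close>.
\<close>

lemma norm_rl_integral_le:
  fixes f :: "real \<Rightarrow> 'b::banach"
  assumes "0 < \<alpha>"
  shows "ennreal (norm (rl_integral \<alpha> t0 f t))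
    \<le> ennreal (1 / Gamma \<alpha>) * kernel_integral \<alpha> t0 (\<lambda>s. norm (f s)) t"
proof (cases "rl_integral_exists \<alpha> t0 f t")
  case True
  have zero: "has_strong_bochner_integral (lebesgue_on {t0..t}) (\<lambda>s. (t - s) powr (\<alpha> - 1) *\<^sub>R (0::'b)) 0"
    by (simp add: has_strong_bochner_integral_zero)
  then have "rl_integral_exists \<alpha> t0 (\<lambda>_. 0::'b) t"
    unfolding rl_integral_exists_def strong_bochner_integrable_def by blast
  moreover have "rl_integral \<alpha> t0 (\<lambda>_. 0::'b) t = 0"
    using strong_bochner_integral_eq[OF zero] by (simp add: rl_integral_def)
  ultimately show ?thesis
    using norm_rl_integral_diff_le[OF True _ assms, of "\<lambda>_. 0"] by simp
next
  case False
  then show ?thesis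
    by (simp add: rl_integral_def rl_integral_exists_def strong_bochner_integral_def)
qed

text \<open>
  Decompose \<open>v\<close> into the sets \<open>A x\<close> on which it has the value \<open>x\<close>. Wherever all the scalar integrals
  \<open>g x t\<close> of the kernel over \<open>A x\<close> are finite, that is almost everywhere, linearity expresses the fractional
  integral of \<open>v\<close> through them, and each \<open>g x\<close> is measurable.
\<close>

lemma bochner_measurable_rl_integral_simple:
  fixes v :: "real \<Rightarrow> 'b::banach"
  assumes v: "simple_function (lebesgue_on {t0..b}) v" and "0 < \<alpha>" "t0 \<le> b"
  shows "bochner_measurable (lebesgue_on {t0..b}) (rl_integral \<alpha> t0 v)"
proof -
  let ?M = "lebesgue_on {t0..b}"
  define X where "X = v ` {t0..b}"
  define A where "A x = v -` {x} \<inter> {t0..b}" for x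
  have X: "finite X"
    using simple_functionD(1)[OF v] by (simp add: X_def)
  have A[measurable]: "A x \<in> sets ?M" for x
    using simple_functionD(2)[OF v, of "{x}"] by (simp add: A_def)
  define g where "g x = kernel_integral \<alpha> t0 (indicator (A x))" for x
  have g_meas[measurable]: "g x \<in> borel_measurable ?M" for x
    unfolding g_def by (rule borel_measurable_kernel_integral) measurable
  have "AE t in ?M. g x t < \<infinity>" for x
    unfolding g_def
  proof (rule AE_kernel_integral_finite)
    have "emeasure ?M (A x) \<le> emeasure ?M {t0..b}"
      by (rule emeasure_mono) (auto simp: A_def)
    also have "\<dots> < \<infinity>"
      by (simp add: emeasure_restrict_space emeasure_lborel_Icc_eq)
    finally show "(\<integral>\<^sup>+s. indicator (A x) s \<partial>?M) < \<infinity>"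
      by simp
  qed (use assms in auto)
  then have "AE t in ?M. \<forall>x\<in>X. g x t < \<infinity>"
    by (intro eventually_ball_finite X ballI)
  then have "AE t in ?M. (1 / Gamma \<alpha>) *\<^sub>R (\<Sum>x\<in>X. enn2real (g x t) *\<^sub>R x) = rl_integral \<alpha> t0 v t"
  proof (rule lebesgue_on_mono)
    fix t assume fin: "\<forall>x\<in>X. g x t < \<infinity>" and t: "t \<in> {t0..b}"
    let ?k = "\<lambda>s. (t - s) powr (\<alpha> - 1)"
    have "has_strong_bochner_integral (lebesgue_on {t0..t})
        (\<lambda>s. (?k s * indicator (A x) s) *\<^sub>R x) (enn2real (g x t) *\<^sub>R x)" if "x \<in> X" for x
    proof (intro has_strong_bochner_integral_scaleR_left has_bochner_integral_nn_integral)
      have "indicat_real (A x) \<in> borel_measurable (lebesgue_on {t0..b})"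
        by measurable
      then have "indicat_real (A x) \<in> borel_measurable (lebesgue_on {t0..t})"
        by (rule measurable_restrict_mono) (use t in auto)
      then show "(\<lambda>s. ?k s * indicator (A x) s) \<in> borel_measurable (lebesgue_on {t0..t})"
        by (intro borel_measurable_times kernel_measurable_lebesgue_on)
      have "(\<integral>\<^sup>+s. ennreal (?k s * indicator (A x) s) \<partial>lebesgue_on {t0..t}) = g x t"
        unfolding g_def kernel_integral_def
        by (intro nn_integral_cong) (auto split: split_indicator)
      then show "(\<integral>\<^sup>+s. ennreal (?k s * indicator (A x) s) \<partial>lebesgue_on {t0..t}) = ennreal (enn2real (g x t))"
        using fin that by simp
    qed auto
    then have "has_strong_bochner_integral (lebesgue_on {t0..t})
        (\<lambda>s. \<Sum>x\<in>X. (?k s * indicator (A x) s) *\<^sub>R x) (\<Sum>x\<in>X. enn2real (g x t) *\<^sub>R x)"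
      by (rule has_strong_bochner_integral_sum)
    moreover have "(\<Sum>x\<in>X. (?k s * indicator (A x) s) *\<^sub>R x) = ?k s *\<^sub>R v s" if "s \<in> {t0..t}" for s
    proof -
      have s: "s \<in> {t0..b}" using that t by auto
      have "(\<Sum>x\<in>X. (?k s * indicator (A x) s) *\<^sub>R x) = (\<Sum>x\<in>X. if x = v s then ?k s *\<^sub>R x else 0)"
        using s by (intro sum.cong) (auto simp: A_def)
      also have "\<dots> = ?k s *\<^sub>R v s"
        using X s by (subst sum.delta) (auto simp: X_def)
      finally show ?thesis .
    qed
    ultimately have "has_strong_bochner_integral (lebesgue_on {t0..t})
        (\<lambda>s. ?k s *\<^sub>R v s) (\<Sum>x\<in>X. enn2real (g x t) *\<^sub>R x)"
      by (rule has_strong_bochner_integral_cong_AE[OF _ AE_I2]) simp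
    then show "(1 / Gamma \<alpha>) *\<^sub>R (\<Sum>x\<in>X. enn2real (g x t) *\<^sub>R x) = rl_integral \<alpha> t0 v t"
      by (simp add: rl_integral_def strong_bochner_integral_eq)
  qed
  moreover have "bochner_measurable ?M (\<lambda>t. (1 / Gamma \<alpha>) *\<^sub>R (\<Sum>x\<in>X. enn2real (g x t) *\<^sub>R x))"
  proof (intro bochner_measurable_scaleR bochner_measurable_sum)
    show "(\<lambda>t. enn2real (g x t)) \<in> borel_measurable ?M" for x
      by measurable
  qed (auto intro: simple_function_imp_bochner_measurable)
  ultimately show ?thesis
    by (rule bochner_measurable_cong_AE[rotated])
qed

text \<open>
  Given strong measurability, integrability follows from the scalar \<open>L\<^sup>1\<close> bound.
\<close>

lemma strong_bochner_integrable_rl_integralI: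
  fixes f :: "real \<Rightarrow> 'b::banach"
  assumes f: "strong_bochner_integrable (lebesgue_on {t0..b}) f"
    and meas: "bochner_measurable (lebesgue_on {t0..b}) (rl_integral \<alpha> t0 f)"
    and "0 < \<alpha>" "t0 \<le> b"
  shows "strong_bochner_integrable (lebesgue_on {t0..b}) (rl_integral \<alpha> t0 f)"
proof -
  let ?M = "lebesgue_on {t0..b}" and ?\<phi> = "\<lambda>s. ennreal (norm (f s))"
  have f': "bochner_measurable ?M f" "(\<integral>\<^sup>+s. ?\<phi> s \<partial>?M) < \<infinity>"
    using f by (auto simp: strong_bochner_integrable_iff)
  have \<phi>: "?\<phi> \<in> borel_measurable ?M"
    using borel_measurable_norm_lebesgue_on[OF f'(1)] by simp
  have "(\<integral>\<^sup>+t. norm (rl_integral \<alpha> t0 f t) \<partial>?M)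
      \<le> (\<integral>\<^sup>+t. ennreal (1 / Gamma \<alpha>) * kernel_integral \<alpha> t0 ?\<phi> t \<partial>?M)"
    by (intro nn_integral_mono norm_rl_integral_le \<open>0 < \<alpha>\<close>)
  also have "\<dots> = ennreal (1 / Gamma \<alpha>) * (\<integral>\<^sup>+t. kernel_integral \<alpha> t0 ?\<phi> t \<partial>?M)"
    by (rule nn_integral_cmult[OF borel_measurable_kernel_integral[OF \<phi>]])
  also have "\<dots> \<le> ennreal (1 / Gamma \<alpha>) *
      (ennreal ((b - t0) powr \<alpha> / \<alpha>) * (\<integral>\<^sup>+s. ?\<phi> s \<partial>?M))"
    by (intro mult_left_mono nn_integral_kernel_integral_le[OF \<phi>] assms) simp
  also have "\<dots> < \<infinity>"
    using f'(2) by (simp add: ennreal_mult_less_top)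
  finally show ?thesis
    using meas by (simp add: strong_bochner_integrable_iff)
qed

text \<open>
  Strong measurability passes from simple functions to \<open>f\<close>: applied to the norm of \<open>f s - v n s\<close>, the
  scalar \<open>L\<^sup>1\<close> bound shows that the majorants \<open>e n\<close> tend to \<open>0\<close> in \<open>L\<^sup>1\<close>.
\<close>

lemma strong_bochner_integrable_rl_integral:
  fixes f :: "real \<Rightarrow> 'b::banach"
  assumes f: "strong_bochner_integrable (lebesgue_on {t0..b}) f" and \<alpha>: "0 < \<alpha>" and b: "t0 \<le> b"
  shows "strong_bochner_integrable (lebesgue_on {t0..b}) (rl_integral \<alpha> t0 f)"
proof -
  let ?M = "lebesgue_on {t0..b}"
  obtain v where v: "\<And>n. Bochner_Integration.simple_bochner_integrable ?M (v n)"
    and lim: "(\<lambda>n. \<integral>\<^sup>+s. norm (f s - v n s) \<partial>?M) \<longlonglongrightarrow> 0"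
    using f unfolding strong_bochner_integrable_def has_strong_bochner_integral_def by blast
  have f_meas: "bochner_measurable ?M f"
    using f by (simp add: strong_bochner_integrable_iff)
  have v_int: "strong_bochner_integrable ?M (v n)" for n
    using simple_bochner_integrableD(2)[OF v] v
    by (rule strong_bochner_integrableI_sequence[where s="\<lambda>_. v n"]) simp
  define \<phi> where "\<phi> n s = ennreal (norm (f s - v n s))" for n s
  have \<phi>: "\<phi> n \<in> borel_measurable ?M" for n
    using borel_measurable_norm_lebesgue_on[OF
        bochner_measurable_diff[OF f_meas simple_bochner_integrableD(2)[OF v]]]
    unfolding \<phi>_def by simp
  define e where "e n t = ennreal (1 / Gamma \<alpha>) * kernel_integral \<alpha> t0 (\<phi> n) t" for n t
  have "bochner_measurable ?M (rl_integral \<alpha> t0 f)"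
  proof (rule bochner_measurable_L1_limit)
    show "strong_bochner_integrable ?M (rl_integral \<alpha> t0 (v n))" for n
      by (intro strong_bochner_integrable_rl_integralI v_int \<alpha> b
          bochner_measurable_rl_integral_simple simple_bochner_integrableD(1)[OF v])
    show "e n \<in> borel_measurable ?M" for n
      unfolding e_def using borel_measurable_kernel_integral[OF \<phi>] by measurable
    show "AE t in ?M. ennreal (norm (rl_integral \<alpha> t0 f t - rl_integral \<alpha> t0 (v n) t)) \<le> e n t" for n
      using AE_rl_integral_exists[OF f \<alpha> b] AE_rl_integral_exists[OF v_int \<alpha> b, of n]
    proof eventually_elim
      case (elim t)
      then show ?case
        using norm_rl_integral_diff_le[OF _ _ \<alpha>] unfolding e_def \<phi>_def by blast
    qed
    let ?C = "ennreal (1 / Gamma \<alpha>) * ennreal ((b - t0) powr \<alpha> / \<alpha>)"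
    have e_le: "(\<integral>\<^sup>+t. e n t \<partial>?M) \<le> ?C * (\<integral>\<^sup>+s. norm (f s - v n s) \<partial>?M)" for n
    proof -
      have "(\<integral>\<^sup>+t. e n t \<partial>?M) = ennreal (1 / Gamma \<alpha>) * (\<integral>\<^sup>+t. kernel_integral \<alpha> t0 (\<phi> n) t \<partial>?M)"
        unfolding e_def by (rule nn_integral_cmult[OF borel_measurable_kernel_integral[OF \<phi>]])
      also have "\<dots> \<le> ennreal (1 / Gamma \<alpha>) * (ennreal ((b - t0) powr \<alpha> / \<alpha>) * (\<integral>\<^sup>+s. \<phi> n s \<partial>?M))"
        by (intro mult_left_mono nn_integral_kernel_integral_le[OF \<phi>] \<alpha> b) simp
      finally show ?thesis
        by (simp add: \<phi>_def mult.assoc)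
    qed
    have "(\<lambda>n. ?C * (\<integral>\<^sup>+s. norm (f s - v n s) \<partial>?M)) \<longlonglongrightarrow> ?C * 0"
      by (rule ennreal_tendsto_cmult[OF _ lim]) (simp add: ennreal_mult_less_top)
    then have C_lim: "(\<lambda>n. ?C * (\<integral>\<^sup>+s. norm (f s - v n s) \<partial>?M)) \<longlonglongrightarrow> 0"
      by simp
    show "(\<lambda>n. \<integral>\<^sup>+t. e n t \<partial>?M) \<longlonglongrightarrow> 0"
      by (rule tendsto_sandwich[OF _ always_eventually tendsto_const C_lim]) (simp_all add: e_le)
  qed
  then show ?thesis
    by (rule strong_bochner_integrable_rl_integralI[OF f _ \<alpha> b])
qed

theorem theorem8:
  fixes t0 t1 \<alpha> :: real and f :: "real \<Rightarrow> 'x::banach"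
  assumes "t0 < t1" and "\<alpha> > 0"
  shows "((\<forall>b\<in>{t0<..<t1}. f \<in> bochner_L1 t0 b) \<longleftrightarrow>
           (AE t in lebesgue_on {t0..t1}. rl_integral_exists \<alpha> t0 f t)) \<and>
         (f \<in> bochner_L1 t0 t1 \<longrightarrow>
           (AE t in lebesgue_on {t0..t1}. rl_integral_exists \<alpha> t0 f t) \<and>
           strong_bochner_integrable (lebesgue_on {t0..t1}) (\<lambda>t. rl_integral \<alpha> t0 f t))"
proof (intro conjI iffI impI)
  assume L1: "\<forall>b\<in>{t0<..<t1}. f \<in> bochner_L1 t0 b"
  show "AE t in lebesgue_on {t0..t1}. rl_integral_exists \<alpha> t0 f t"
  proof (rule AE_lebesgue_on_Icc_exhaust[OF _ \<open>t0 < t1\<close>])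
    fix b assume "t0 < b" "b < t1"
    then show "AE t in lebesgue_on {t0..b}. rl_integral_exists \<alpha> t0 f t"
      using L1 \<open>\<alpha> > 0\<close>
      by (intro AE_rl_integral_exists) (auto simp: bochner_L1_iff_strong_bochner_integrable)
  qed
next
  assume ex: "AE t in lebesgue_on {t0..t1}. rl_integral_exists \<alpha> t0 f t"
  show "\<forall>b\<in>{t0<..<t1}. f \<in> bochner_L1 t0 b"
  proof
    fix b assume b: "b \<in> {t0<..<t1}"
    obtain t where "b < t" "rl_integral_exists \<alpha> t0 f t"
      using AE_lebesgue_on_Icc_witness[OF ex, of b] b by auto
    then show "f \<in> bochner_L1 t0 b"
      using b by (auto simp: bochner_L1_iff_strong_bochner_integrable
          intro: strong_bochner_integrable_if_rl_integral_exists)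
  qed
next
  assume "f \<in> bochner_L1 t0 t1"
  then have f: "strong_bochner_integrable (lebesgue_on {t0..t1}) f"
    by (simp add: bochner_L1_iff_strong_bochner_integrable)
  show "AE t in lebesgue_on {t0..t1}. rl_integral_exists \<alpha> t0 f t"
    using assms by (intro AE_rl_integral_exists[OF f]) auto
  show "strong_bochner_integrable (lebesgue_on {t0..t1}) (\<lambda>t. rl_integral \<alpha> t0 f t)"
    using assms strong_bochner_integrable_rl_integral[OF f] by simp
qed

end
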